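(* Let $0<\varepsilon<1/4$, let $k\ge l$ be positive integers, and let $G$ be a graph on $n\ge k+\lfloor(l+1)/2\rfloor+60\varepsilon k$ vertices with minimum degree at least $(1-\varepsilon)n$. Then $G\rightarrow (P_{k+1},P_{l+1})$.
   Context: $P_m$ denotes the path on $m$ vertices. For graphs $G,F,H$, $G\rightarrow (F,H)$ means that for every colouring of the edges of $G$ with red and blue there is a red copy of $F$ or a blue copy of $H$. *)

theory Defs
  imports Complex_Main
begin

record 'a ugraph =
  verts :: "'a set"
  edges :: "'a set set"

definition simple_graph :: "'a ugraph \<Rightarrow> bool" where
  "simple_graph G \<longleftrightarrow> finite (verts G) \<and> (\<forall>e\<in>edges G. e \<subseteq> verts G \<and> card e = 2)"

definition degree :: "'a ugraph \<Rightarrow> 'a \<Rightarrow> nat" where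
  "degree G v = card {e \<in> edges G. v \<in> e}"

text \<open>Meaningful for graphs with a finite, nonempty vertex set only.\<close>
definition min_degree :: "'a ugraph \<Rightarrow> nat" where
  "min_degree G = Min (degree G ` verts G)"

text \<open>\<open>path_graph m\<close> is the path \<open>P\<^sub>m\<close> on \<open>m\<close> vertices, so it has \<open>m - 1\<close> edges.\<close>
definition path_graph :: "nat \<Rightarrow> nat ugraph" where
  "path_graph m = \<lparr>verts = {..<m}, edges = {{i, Suc i} |i. Suc i < m}\<rparr>"

text \<open>Copies are subgraphs that need not be induced.\<close>
definition contains_copy :: "'a ugraph \<Rightarrow> 'b ugraph \<Rightarrow> bool" where
  "contains_copy G F \<longleftrightarrow>
     (\<exists>f. inj_on f (verts F) \<and> f ` verts F \<subseteq> verts G \<and> (\<forall>e\<in>edges F. f ` e \<in> edges G))"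

datatype colour = Red | Blue

definition colour_subgraph :: "'a ugraph \<Rightarrow> ('a set \<Rightarrow> colour) \<Rightarrow> colour \<Rightarrow> 'a ugraph" where
  "colour_subgraph G c x = \<lparr>verts = verts G, edges = {e \<in> edges G. c e = x}\<rparr>"

definition arrows :: "'a ugraph \<Rightarrow> 'b ugraph \<Rightarrow> 'c ugraph \<Rightarrow> bool" where
  "arrows G F H \<longleftrightarrow>
     (\<forall>c. contains_copy (colour_subgraph G c Red) F \<or> contains_copy (colour_subgraph G c Blue) H)"

end

theory Submission
  imports Defs
begin

text \<open>
  Let \<open>D = \<lfloor>\<epsilon> n\<rfloor>\<close>, so every vertex has at most \<open>D\<close> non-neighbours (itself included) and \<open>D \<ge> 1\<close>; let
  \<open>p\<close> and \<open>q\<close> be the numbers of vertices of the longest red and blue paths. A partition into a red path and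
  two equal sets without red edges between them gives \<open>n \<le> p + q + 2D + 1\<close>; so if the theorem fails, then
  \<open>n \<le> 5k/2\<close> and the term \<open>60 \<epsilon> k\<close> is worth at least \<open>24 D\<close>. By symmetry we may assume \<open>q \<le> p\<close>, with
  \<open>n \<ge> p + q/2 + 24 D\<close>.

  Let \<open>P\<close> be a longest red path and \<open>U\<close> its complement. No one or two vertices of \<open>U\<close> can be spliced into \<open>P\<close>
  so as to prolong it. Consider blue paths with both ends in \<open>U\<close> and no two consecutive vertices in \<open>P\<close>.
  There is one with at least \<open>q/2 - 5D\<close> vertices in \<open>P\<close>; let \<open>Q\<close> be a longest one of this kind, with first
  vertex \<open>u\<close>. Many vertices \<open>w\<close> of \<open>U\<close> are left over, all of them are red to \<open>u\<close>, and \<open>u\<close> and \<open>w\<close> have no common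
  blue neighbour on \<open>P\<close> outside \<open>Q\<close>. This forces \<open>P\<close> to alternate between vertices inside and outside \<open>Q\<close>, up
  to \<open>O(D)\<close> exceptions, and \<open>u\<close> to be red to the latter and blue to the former. Rotating \<open>Q\<close>, we may
  assume that its two ends are adjacent. If they are joined in red, both fit into \<open>P\<close>; if in blue, \<open>Q\<close> closes
  to a cycle, which forces red edges that again prolong \<open>P\<close>.
\<close>

section \<open>Paths as vertex lists: partitions, greedy constructions and counting\<close>

definition path_in :: "('a \<Rightarrow> 'a \<Rightarrow> bool) \<Rightarrow> 'a set \<Rightarrow> 'a list \<Rightarrow> bool" where
  "path_in E S xs \<longleftrightarrow> distinct xs \<and> set xs \<subseteq> S \<and> successively E xs"

lemma successively_take: "successively E xs \<Longrightarrow> successively E (take n xs)"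
  using successively_append_iff[of E "take n xs" "drop n xs"] by simp

lemma successively_drop: "successively E xs \<Longrightarrow> successively E (drop n xs)"
  using successively_append_iff[of E "take n xs" "drop n xs"] by simp

lemma exists_longest_list:
  fixes C :: "'a list \<Rightarrow> bool"
  assumes "C xs0" and "\<And>xs. C xs \<Longrightarrow> length xs \<le> b"
  obtains xs where "C xs" and "\<And>ys. C ys \<Longrightarrow> length ys \<le> length xs"
proof -
  have "\<exists>xs. is_arg_max length C xs"
    using ex_has_greatest_nat[of C xs0 length "Suc b"] assms
    by (auto simp: is_arg_max_linorder intro: le_imp_less_Suc)
  then show ?thesis
    using that by (auto simp: is_arg_max_linorder)
qed

text \<open>This is depth-first search: \<open>xs\<close> is the stack with its top at the head,
  \<open>X\<close> holds the finished vertices and \<open>Y\<close> the unexplored ones. As long as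
  \<open>X\<close> is smaller than \<open>Y\<close>, one can push a vertex of \<open>Y\<close> or
  finish the head; with weight 2 on \<open>X\<close>, either move raises \<open>f\<close> by one, so
  a maximum of \<open>f\<close> balances the two sets.\<close>

lemma path_partition:
  fixes E :: "'a \<Rightarrow> 'a \<Rightarrow> bool"
  assumes fin: "finite V" and sym: "\<And>x y. E x y \<Longrightarrow> E y x"
  obtains xs X Y where "path_in E V xs" "X \<subseteq> V" "Y \<subseteq> V" "X \<inter> Y = {}" "card X = card Y"
    "card V = length xs + 2 * card X" "\<And>x y. x \<in> X \<Longrightarrow> y \<in> Y \<Longrightarrow> \<not> E x y"
proof -
  define Inv where "Inv = (\<lambda>(xs, X, Y). path_in E V xs \<and> X \<subseteq> V \<and> Y \<subseteq> V \<and> X \<inter> Y = {} \<and>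
    set xs \<inter> X = {} \<and> set xs \<inter> Y = {} \<and> V = set xs \<union> X \<union> Y \<and> card X \<le> card Y \<and>
    (\<forall>x\<in>X. \<forall>y\<in>Y. \<not> E x y))"
  define f where "f = (\<lambda>(xs :: 'a list, X :: 'a set, Y :: 'a set). 2 * card X + length xs)"
  have "Inv ([], {}, V)" by (auto simp: Inv_def path_in_def)
  moreover have "f z < Suc (3 * card V)" if "Inv z" for z
  proof -
    obtain xs X Y where z: "z = (xs, X, Y)" by (cases z)
    have "distinct xs" "set xs \<subseteq> V" "X \<subseteq> V" using that by (auto simp: Inv_def z path_in_def)
    then have "length xs = card (set xs)" "card (set xs) \<le> card V" "card X \<le> card V"
      using fin card_mono[of V] by (metis distinct_card)+
    then show ?thesis by (simp add: f_def z)
  qed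
  ultimately obtain z where z: "Inv z" and max: "\<And>z'. Inv z' \<Longrightarrow> f z' \<le> f z"
    using ex_has_greatest_nat[of Inv "([], {}, V)" f "Suc (3 * card V)"] by blast
  obtain xs X Y where zd: "z = (xs, X, Y)" by (cases z)
  have I: "path_in E V xs" "X \<subseteq> V" "Y \<subseteq> V" "X \<inter> Y = {}" "set xs \<inter> X = {}" "set xs \<inter> Y = {}"
    "V = set xs \<union> X \<union> Y" "card X \<le> card Y" "\<And>x y. x \<in> X \<Longrightarrow> y \<in> Y \<Longrightarrow> \<not> E x y"
    using z by (auto simp: Inv_def zd)
  have finXY: "finite X" "finite Y" using I fin by (auto intro: finite_subset)
  have "card X = card Y"
  proof (rule ccontr)
    assume "card X \<noteq> card Y"
    with I have less: "card X < card Y" by simp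
    then obtain y where y: "y \<in> Y" by fastforce
    have grow: False if "y \<in> Y" "xs = [] \<or> E y (hd xs)" for y
    proof -
      have "Inv (y # xs, X, Y - {y})"
        using I that less finXY by (auto simp: Inv_def path_in_def successively_Cons)
      from max[OF this] show False by (simp add: f_def zd)
    qed
    with y have ne: "xs \<noteq> []" by blast
    then obtain v vs where xs: "xs = v # vs" by (cases xs) auto
    have "\<not> E v y" if "y \<in> Y" for y using grow[OF that] sym xs by auto
    then have "Inv (vs, insert v X, Y)"
      using I less finXY xs by (auto simp: Inv_def path_in_def successively_Cons)
    from max[OF this] show False using I finXY xs by (simp add: f_def zd)
  qed
  moreover have "card V = length xs + 2 * card X"
  proof -
    have "card V = card (set xs) + card X + card Y"
      using I finXY by (subst I(7)) (auto simp: card_Un_disjoint Int_Un_distrib2)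
    moreover have "card (set xs) = length xs" using I(1) by (simp add: path_in_def distinct_card)
    ultimately show ?thesis using \<open>card X = card Y\<close> by simp
  qed
  ultimately show ?thesis using that I by blast
qed

lemma ex_in_diff:
  assumes "finite S" "card A + card C < card S" "finite A" "finite C"
  shows "\<exists>x\<in>S. x \<notin> A \<and> x \<notin> C"
proof (rule ccontr)
  assume "\<not> ?thesis"
  then have "S \<subseteq> A \<union> C" by auto
  then have "card S \<le> card (A \<union> C)" using assms by (intro card_mono) auto
  also have "\<dots> \<le> card A + card C" by (rule card_Un_le)
  finally show False using assms by simp
qed

lemma greedy_path:
  assumes fin: "finite S" and w: "w \<in> S"
    and deg: "\<And>x. x \<in> S \<Longrightarrow> card {y \<in> S. y \<noteq> x \<and> \<not> E y x} \<le> d"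
    and m: "1 \<le> m" "m + d \<le> card S"
  shows "\<exists>xs. path_in E S xs \<and> length xs = m \<and> last xs = w"
  using m
proof (induction m rule: nat_induct_at_least)
  case base
  show ?case using w by (intro exI[of _ "[w]"]) (auto simp: path_in_def)
next
  case (Suc m)
  then obtain xs where xs: "path_in E S xs" "length xs = m" "last xs = w" by auto
  then have ne: "xs \<noteq> []" using Suc by auto
  then have hd: "hd xs \<in> S" "hd xs \<in> set xs" using xs by (auto simp: path_in_def)
  have "card (set xs) = m" using xs by (simp add: path_in_def distinct_card)
  with deg[OF hd(1)] Suc.prems
  have "card (set xs) + card {y \<in> S. y \<noteq> hd xs \<and> \<not> E y (hd xs)} < card S" by simp
  from ex_in_diff[OF fin this] fin hd obtain y where "y \<in> S" "y \<notin> set xs" "E y (hd xs)" by fastforce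
  then show ?case using xs ne
    by (intro exI[of _ "y # xs"]) (auto simp: path_in_def successively_Cons)
qed

text \<open>The path is grown at its head by a vertex of \<open>X\<close> and then one of
  \<open>W\<close>, so that \<open>w\<close> stays last and both ends lie in \<open>W\<close>. The
  condition on edges is carried along because sparse blue paths will ask for it.\<close>

lemma greedy_alternating_path:
  assumes fin: "finite X" "finite W" and disj: "X \<inter> W = {}" and w: "w \<in> W"
    and degW: "\<And>y. y \<in> W \<Longrightarrow> card {x \<in> X. \<not> E x y} \<le> d1"
    and degX: "\<And>x. x \<in> X \<Longrightarrow> card {y \<in> W. \<not> E y x} \<le> d2"
    and m: "m + d1 \<le> card X" "m + 1 + d2 \<le> card W"
  shows "\<exists>xs. path_in (\<lambda>x y. E x y \<and> (x \<in> W \<or> y \<in> W)) (X \<union> W) xs \<and> xs \<noteq> [] \<and> last xs = w \<and> hd xs \<in> W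
     \<and> card (set xs \<inter> X) = m \<and> card (set xs \<inter> W) = m + 1"
  using m
proof (induction m)
  case 0
  show ?case using w disj by (intro exI[of _ "[w]"]) (auto simp: path_in_def)
next
  case (Suc m)
  then obtain xs where xs: "path_in (\<lambda>x y. E x y \<and> (x \<in> W \<or> y \<in> W)) (X \<union> W) xs" "xs \<noteq> []"
      "last xs = w" "hd xs \<in> W" "card (set xs \<inter> X) = m" "card (set xs \<inter> W) = m + 1"
    by auto
  have "card (set xs \<inter> X) + card {x \<in> X. \<not> E x (hd xs)} < card X"
    using xs degW[OF xs(4)] Suc.prems by simp
  from ex_in_diff[OF fin(1) this] fin obtain x where x: "x \<in> X" "x \<notin> set xs" "E x (hd xs)" by auto
  have "card (set xs \<inter> W) + card {y \<in> W. \<not> E y x} < card W"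
    using xs degX[OF x(1)] Suc.prems by simp
  from ex_in_diff[OF fin(2) this] fin obtain y where y: "y \<in> W" "y \<notin> set xs" "E y x" by auto
  have xy: "x \<notin> W" "y \<notin> X" using x y disj by auto
  have "card (set (y # x # xs) \<inter> X) = Suc m" "card (set (y # x # xs) \<inter> W) = Suc m + 1"
    using xs x y xy by (auto simp: Int_insert_left)
  moreover have "path_in (\<lambda>x y. E x y \<and> (x \<in> W \<or> y \<in> W)) (X \<union> W) (y # x # xs)"
    using xs x y xy by (auto simp: path_in_def successively_Cons)
  ultimately show ?case using xs y by (intro exI[of _ "y # x # xs"]) auto
qed

text \<open>Each entry outside \<open>U\<close> is followed by one in \<open>U\<close>, since the
  last entry is in \<open>U\<close>; a head in \<open>U\<close> is left over.\<close>

lemma sparse_list_count: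
  assumes "xs \<noteq> []" "successively (\<lambda>x y. x \<in> U \<or> y \<in> U) xs" "last xs \<in> U"
  shows "(hd xs \<in> U \<longrightarrow> length (filter (\<lambda>x. x \<notin> U) xs) + 1 \<le> length (filter (\<lambda>x. x \<in> U) xs))
    \<and> length (filter (\<lambda>x. x \<notin> U) xs) \<le> length (filter (\<lambda>x. x \<in> U) xs)"
  using assms
proof (induction xs rule: induct_list012)
  case (3 x y zs)
  then show ?case by (cases "y \<in> U") auto
qed auto

text \<open>The offset \<open>d\<close> lets one bound serve for the vertex at a position of a path
  and for those one or two places further on.\<close>

lemma card_nth_vimage_le:
  assumes "distinct xs" "finite A"
  shows "card {i. i + d < length xs \<and> xs ! (i + d) \<in> A} \<le> card A"
proof (rule card_inj_on_le[of "\<lambda>i. xs ! (i + d)"])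
  show "inj_on (\<lambda>i. xs ! (i + d)) {i. i + d < length xs \<and> xs ! (i + d) \<in> A}"
    using assms by (auto simp: inj_on_def nth_eq_iff_index_eq)
qed (use assms in auto)

section \<open>Two-coloured graphs in which few pairs are non-adjacent\<close>

locale two_coloured =
  fixes V :: "'a set" and R B :: "'a \<Rightarrow> 'a \<Rightarrow> bool" and D :: nat
  assumes finV: "finite V"
    and irreflR: "\<And>x. \<not> R x x"
    and symR: "\<And>x y. R x y \<Longrightarrow> R y x" and symB: "\<And>x y. B x y \<Longrightarrow> B y x"
    and few_nonadj: "\<And>v. v \<in> V \<Longrightarrow> card {x \<in> V. \<not> (R v x \<or> B v x)} \<le> D"
    and D_pos: "1 \<le> D"
begin

definition "adj x y \<longleftrightarrow> R x y \<or> B x y"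

lemma adj_sym: "adj x y \<longleftrightarrow> adj y x"
  using symR symB by (auto simp: adj_def)

lemma card_nonadj_le: "v \<in> V \<Longrightarrow> S \<subseteq> V \<Longrightarrow> card {x \<in> S. \<not> adj v x} \<le> D"
  using few_nonadj[of v] card_mono[of "{x \<in> V. \<not> adj v x}" "{x \<in> S. \<not> adj v x}"] finV
  by (fastforce simp: adj_def)

text \<open>Each vertex of \<open>vs\<close> rules out at most \<open>D\<close> elements of
  \<open>S\<close>.\<close>

lemma ex_adj_all:
  assumes "S \<subseteq> V" "set vs \<subseteq> V" "length vs * D < card S"
  shows "\<exists>w\<in>S. \<forall>v\<in>set vs. adj v w"
  using assms
proof (induction vs arbitrary: S)
  case Nil
  then have "S \<noteq> {}" by auto
  then show ?case by auto
next
  case (Cons v vs)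
  let ?S = "{x \<in> S. adj v x}"
  have fS: "finite S" using Cons.prems finV finite_subset by blast
  have "card S = card ?S + card {x \<in> S. \<not> adj v x}"
    using fS by (subst card_Un_disjoint[symmetric]) (auto intro: arg_cong[of _ _ card])
  then have "length vs * D < card ?S" using card_nonadj_le[of v S] Cons.prems by auto
  then obtain w where "w \<in> ?S" "\<forall>v\<in>set vs. adj v w" using Cons.IH[of ?S] Cons.prems by auto
  then show ?case by auto
qed

text \<open>In a partition for \<open>R\<close>, the adjacent pairs between \<open>X\<close> and
  \<open>Y\<close> are blue. Unless \<open>X\<close> has at most \<open>D\<close> vertices, a greedy
  blue path alternates between the sets and has \<open>2 * (card X - D) - 1\<close> vertices, which
  bounds \<open>2 * card X\<close> by \<open>q + 2 * D + 1\<close>.\<close>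

lemma card_le_longest_paths:
  assumes red: "\<And>xs. path_in R V xs \<Longrightarrow> length xs \<le> p"
    and blue: "\<And>xs. path_in B V xs \<Longrightarrow> length xs \<le> q"
  shows "card V \<le> p + q + 2 * D + 1"
proof -
  obtain xs X Y where xs: "path_in R V xs" "X \<subseteq> V" "Y \<subseteq> V" "X \<inter> Y = {}" "card X = card Y"
    "card V = length xs + 2 * card X" and no: "\<And>x y. x \<in> X \<Longrightarrow> y \<in> Y \<Longrightarrow> \<not> R x y"
    using path_partition[of V R] finV symR by metis
  show ?thesis
  proof (cases "card X \<le> D")
    case True
    then show ?thesis using xs red[OF xs(1)] by simp
  next
    case False
    have fin: "finite X" "finite Y" using xs finV finite_subset by blast+
    define m where "m = card X - D - 1"
    obtain y where y: "y \<in> Y" using False xs by fastforce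
    have "card {x \<in> X. \<not> B x y} \<le> D" if "y \<in> Y" for y
    proof -
      have "{x \<in> X. \<not> B x y} = {x \<in> X. \<not> adj y x}" using no that symR symB by (auto simp: adj_def)
      then show ?thesis using card_nonadj_le[of y X] xs that by auto
    qed
    moreover have "card {y \<in> Y. \<not> B y x} \<le> D" if "x \<in> X" for x
    proof -
      have "{y \<in> Y. \<not> B y x} = {y \<in> Y. \<not> adj x y}" using no that symR symB by (auto simp: adj_def)
      then show ?thesis using card_nonadj_le[of x Y] xs that by auto
    qed
    ultimately obtain zs where zs: "path_in (\<lambda>x y. B x y \<and> (x \<in> Y \<or> y \<in> Y)) (X \<union> Y) zs"
        "card (set zs \<inter> X) = m" "card (set zs \<inter> Y) = m + 1"
      using greedy_alternating_path[OF fin xs(4) y, of B D D m] False xs(5) m_def by auto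
    have "path_in B V zs"
      using zs(1) xs by (auto simp: path_in_def elim: successively_mono)
    then have "length zs \<le> q" by (rule blue)
    moreover have "length zs = card (set zs \<inter> X) + card (set zs \<inter> Y)"
    proof -
      have "card (set zs \<inter> X) + card (set zs \<inter> Y) = card (set zs \<inter> X \<union> set zs \<inter> Y)"
        using xs(4) by (intro card_Un_disjoint[symmetric]) auto
      also have "set zs \<inter> X \<union> set zs \<inter> Y = set zs" using zs(1) by (auto simp: path_in_def)
      finally show ?thesis using zs(1) by (simp add: path_in_def distinct_card)
    qed
    ultimately show ?thesis using zs xs red[OF xs(1)] m_def False by simp
  qed
qed

end

section \<open>A longest red path and its complement\<close>

locale extremal_colouring = two_coloured +
  fixes P :: "'a list" and q :: nat
  assumes red_P: "path_in R V P"
    and red_le: "\<And>xs. path_in R V xs \<Longrightarrow> length xs \<le> length P"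
    and blue_le: "\<And>xs. path_in B V xs \<Longrightarrow> length xs \<le> q"
    and q_le: "q \<le> length P"
    and V_large: "2 * length P + q + 48 * D \<le> 2 * card V"
begin

definition "U = V - set P"

lemma P_props: "distinct P" "set P \<subseteq> V" "successively R P"
  using red_P by (auto simp: path_in_def)

lemma finU: "finite U" "U \<subseteq> V" using finV by (auto simp: U_def)

lemma nth_P_in: "i < length P \<Longrightarrow> P ! i \<in> V" "i < length P \<Longrightarrow> P ! i \<notin> U"
  using P_props by (auto simp: U_def)

lemma card_V: "card V = length P + card U"
  using P_props finV card_mono[of V "set P"] by (simp add: U_def card_Diff_subset distinct_card)

lemma card_U: "q + 48 * D \<le> 2 * card U"
  using card_V V_large by simp

text \<open>By \<open>card_le_longest_paths\<close>, \<open>U\<close> has at most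
  \<open>q + 2 * D + 1\<close> vertices. By \<open>V_large\<close>, which is doubled only to avoid
  halves, it has at least \<open>q / 2 + 24 * D\<close>.\<close>

lemma q_large: "42 * D \<le> q"
  using card_le_longest_paths[OF red_le blue_le] card_V card_U D_pos by simp

text \<open>Putting \<open>zs\<close> in place of the \<open>j - i - 1\<close> vertices strictly
  between \<open>P ! i\<close> and \<open>P ! j\<close> yields a red path, which cannot be longer
  than \<open>P\<close>.\<close>

lemma splice_le:
  assumes "i < j" "j < length P" "zs \<noteq> []" "path_in R U zs"
    "R (P ! i) (hd zs)" "R (last zs) (P ! j)"
  shows "length zs \<le> j - i - 1"
proof -
  have "set (take (Suc i) P) \<inter> set (drop j P) = {}"
    using P_props assms by (intro set_take_disj_set_drop_if_distinct) auto
  moreover have "set (take (Suc i) P) \<subseteq> set P" "set (drop j P) \<subseteq> set P"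
    by (auto dest: in_set_takeD in_set_dropD)
  moreover have "last (take (Suc i) P) = P ! i" "hd (drop j P) = P ! j"
    using assms by (auto simp: take_Suc_conv_app_nth hd_drop_conv_nth)
  moreover have "successively R (take (Suc i) P)" "successively R (drop j P)"
    using P_props(3) by (rule successively_take successively_drop)+
  moreover have "set zs \<inter> set P = {}" using assms by (auto simp: path_in_def U_def)
  ultimately have "path_in R V (take (Suc i) P @ zs @ drop j P)"
    using P_props assms by (auto simp: path_in_def successively_append_iff U_def)
  from red_le[OF this] show ?thesis using assms by simp
qed

text \<open>Symmetric in \<open>x\<close> and \<open>y\<close>, so that splicing does not depend on
  the direction in which \<open>P\<close> is traversed.\<close>

definition "consecutive x y \<longleftrightarrow>
  (\<exists>i. i + 1 < length P \<and> (x = P ! i \<and> y = P ! (i + 1) \<or> x = P ! (i + 1) \<and> y = P ! i))"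

lemma consecutive_sym: "consecutive x y \<longleftrightarrow> consecutive y x"
  by (auto simp: consecutive_def)

lemma consecutive_nth: "i + 1 < length P \<Longrightarrow> consecutive (P ! i) (P ! (i + 1))"
  unfolding consecutive_def by blast

lemma consecutive_in_P: "consecutive x y \<Longrightarrow> x \<in> set P \<and> y \<in> set P"
  by (auto simp: consecutive_def)

lemma no_red_insert1:
  assumes "z \<in> U" "consecutive x y" shows "\<not> (R z x \<and> R z y)"
proof
  assume r: "R z x \<and> R z y"
  obtain i where "i + 1 < length P" "x = P ! i \<and> y = P ! (i + 1) \<or> x = P ! (i + 1) \<and> y = P ! i"
    using assms by (auto simp: consecutive_def)
  then show False
    using splice_le[of i "i + 1" "[z]"] r assms symR by (auto simp: path_in_def)
qed

lemma no_red_insert2: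
  assumes "z \<in> U" "z' \<in> U" "R z z'" "consecutive x y" shows "\<not> (R z x \<and> R z' y)"
proof
  assume r: "R z x \<and> R z' y"
  obtain i where i: "i + 1 < length P" "x = P ! i \<and> y = P ! (i + 1) \<or> x = P ! (i + 1) \<and> y = P ! i"
    using assms by (auto simp: consecutive_def)
  have "z \<noteq> z'" using assms irreflR by auto
  with i show False
    using splice_le[of i "i + 1" "[z, z']"] splice_le[of i "i + 1" "[z', z]"] r assms symR
    by (auto simp: path_in_def)
qed

text \<open>Here two vertices would take the place of the single vertex
  \<open>P ! (i + 1)\<close>.\<close>

lemma no_red_replace:
  assumes "z \<in> U" "z' \<in> U" "R z z'" "i + 2 < length P" shows "\<not> (R z (P ! i) \<and> R z' (P ! (i + 2)))"
  using splice_le[of i "i + 2" "[z, z']"] assms symR irreflR by (auto simp: path_in_def)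

section \<open>Blue paths without two consecutive vertices in \<open>P\<close>\<close>

definition "sparse_blue xs \<longleftrightarrow> path_in (\<lambda>x y. B x y \<and> (x \<in> U \<or> y \<in> U)) V xs \<and> xs \<noteq> [] \<and> hd xs \<in> U \<and> last xs \<in> U"

definition "inner xs = card (set xs \<inter> set P)"

lemma sparse_blueD:
  assumes "sparse_blue xs"
  shows "distinct xs" "set xs \<subseteq> V" "successively (\<lambda>x y. B x y \<and> (x \<in> U \<or> y \<in> U)) xs"
    "xs \<noteq> []" "hd xs \<in> U" "last xs \<in> U" "hd xs \<in> V" "length xs \<le> q"
proof -
  show *: "distinct xs" "set xs \<subseteq> V" "successively (\<lambda>x y. B x y \<and> (x \<in> U \<or> y \<in> U)) xs"
    "xs \<noteq> []" "hd xs \<in> U" "last xs \<in> U" "hd xs \<in> V"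
    using assms by (auto simp: sparse_blue_def path_in_def U_def)
  then show "length xs \<le> q"
    by (intro blue_le) (auto simp: path_in_def elim: successively_mono)
qed

text \<open>The weaker first bound serves for end pieces of a sparse path, which may begin in
  \<open>P\<close>.\<close>

lemma inner_bounds:
  assumes "distinct xs" "set xs \<subseteq> V" "successively (\<lambda>x y. B x y \<and> (x \<in> U \<or> y \<in> U)) xs"
    "xs \<noteq> []" "last xs \<in> U"
  shows "2 * inner xs \<le> length xs" "hd xs \<in> U \<Longrightarrow> 2 * inner xs + 1 \<le> length xs"
proof -
  have "successively (\<lambda>x y. x \<in> U \<or> y \<in> U) xs" using assms(3) by (rule successively_mono) auto
  note sparse_list_count[OF assms(4) this assms(5)]
  moreover have "inner xs = length (filter (\<lambda>x. x \<notin> U) xs)"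
    using assms(1,2) unfolding distinct_length_filter[OF assms(1)] inner_def
    by (intro arg_cong[of _ _ card]) (auto simp: U_def)
  moreover note sum_length_filter_compl[of "\<lambda>x. x \<in> U" xs]
  ultimately show "2 * inner xs \<le> length xs" "hd xs \<in> U \<Longrightarrow> 2 * inner xs + 1 \<le> length xs" by auto
qed

lemma sparse_blue_inner: "sparse_blue xs \<Longrightarrow> 2 * inner xs + 1 \<le> length xs"
  using inner_bounds(2)[of xs] sparse_blueD[of xs] by blast

lemma card_outside:
  assumes "sparse_blue xs" shows "card (U - set xs) + length xs = card U + inner xs"
proof -
  note * = sparse_blueD[OF assms]
  have "length xs = card (set xs)" using * by (simp add: distinct_card)
  also have "set xs = (set xs \<inter> set P) \<union> (U \<inter> set xs)" using * by (auto simp: U_def)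
  also have "card \<dots> = inner xs + card (U \<inter> set xs)"
    unfolding inner_def by (intro card_Un_disjoint) (auto simp: U_def)
  finally show ?thesis using card_Diff_subset_Int[of U "set xs"] card_mono[of U "U \<inter> set xs"] finU by auto
qed

lemma sparse_blue_rev: "sparse_blue xs \<Longrightarrow> sparse_blue (rev xs)"
  using symB by (auto simp: sparse_blue_def path_in_def hd_rev last_rev elim!: successively_mono)

lemma card_nonadj_idx: "v \<in> V \<Longrightarrow> card {i. i + d < length P \<and> \<not> adj v (P ! (i + d))} \<le> D"
proof -
  assume v: "v \<in> V"
  have "{i. i + d < length P \<and> \<not> adj v (P ! (i + d))} =
      {i. i + d < length P \<and> P ! (i + d) \<in> {x \<in> V. \<not> adj v x}}"
    using nth_P_in by auto
  also have "card \<dots> \<le> card {x \<in> V. \<not> adj v x}"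
    using P_props finV by (intro card_nth_vimage_le) auto
  also have "\<dots> \<le> D" using v by (intro card_nonadj_le) auto
  finally show ?thesis .
qed

lemma card_in_idx: "card {i. i + d < length P \<and> P ! (i + d) \<in> set xs} \<le> inner xs"
proof -
  have "{i. i + d < length P \<and> P ! (i + d) \<in> set xs} =
      {i. i + d < length P \<and> P ! (i + d) \<in> set xs \<inter> set P}" by auto
  also have "card \<dots> \<le> inner xs"
    unfolding inner_def using P_props by (intro card_nth_vimage_le) auto
  finally show ?thesis .
qed

definition "free_pairs xs = {i. i + 1 < length P \<and> P ! i \<notin> set xs \<and> P ! (i + 1) \<notin> set xs}"

lemma finite_idx: "finite {i. i + d < length P \<and> F i}"
  by (rule finite_subset[of _ "{..<length P}"]) auto

lemma finite_free_pairs: "finite (free_pairs xs)"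
  unfolding free_pairs_def by (rule finite_idx)

text \<open>Each vertex of \<open>P\<close> that lies on \<open>xs\<close> spoils at most two of the
  \<open>length P - 1\<close> pairs.\<close>

lemma card_free_pairs: "length P \<le> card (free_pairs xs) + 1 + 2 * inner xs"
proof -
  let ?A = "\<lambda>d. {i. i + d < length P \<and> P ! (i + d) \<in> set xs}"
  have "{..<length P - 1} \<subseteq> free_pairs xs \<union> (?A 0 \<union> ?A 1)" by (auto simp: free_pairs_def)
  then have "card {..<length P - 1} \<le> card (free_pairs xs \<union> (?A 0 \<union> ?A 1))"
    by (intro card_mono) (simp_all only: finite_free_pairs finite_idx finite_Un)
  also have "\<dots> \<le> card (free_pairs xs) + (card (?A 0) + card (?A 1))"
    by (meson card_Un_le add_left_mono order_trans)
  finally show ?thesis using card_in_idx[of 0 xs] card_in_idx[of 1 xs] by simp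
qed

lemma sparse_blue_Cons:
  assumes "sparse_blue xs" "w \<in> U - set xs" "B w (hd xs)"
  shows "sparse_blue (w # xs)"
  using assms by (auto simp: sparse_blue_def path_in_def U_def successively_Cons)

lemma sparse_blue_Cons2:
  assumes "sparse_blue xs" "w \<in> U - set xs" "x \<in> set P - set xs" "B w x" "B x (hd xs)"
  shows "sparse_blue (w # x # xs)" "inner (w # x # xs) = Suc (inner xs)"
proof -
  show "sparse_blue (w # x # xs)"
    using assms P_props by (auto simp: sparse_blue_def path_in_def U_def successively_Cons)
  have "set (w # x # xs) \<inter> set P = insert x (set xs \<inter> set P)" using assms by (auto simp: U_def)
  then show "inner (w # x # xs) = Suc (inner xs)" using assms by (simp add: inner_def)
qed

text \<open>Take a longest strictly alternating path with first vertex \<open>u\<close>. Of two consecutive vertices of \<open>P\<close> which it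
  misses, one is red to \<open>u\<close> and the other is red, hence the first one blue, to the unused part \<open>W\<close> of \<open>U\<close>.
  So the path can be continued by a blue edge from \<open>u\<close> into \<open>W\<close>, followed by a greedily chosen path
  between \<open>W\<close> and such vertices.\<close>

lemma ex_sparse_blue_many_inner: "\<exists>Q. sparse_blue Q \<and> q \<le> 2 * inner Q + 10 * D"
proof (rule ccontr)
  assume none: "\<not> ?thesis"
  have "0 < card U" using card_U D_pos by simp
  then obtain u0 where "u0 \<in> U" by fastforce
  \<comment> \<open>Together with \<open>sparse_blue_inner\<close>, this upper bound on the length
    says that the path alternates strictly between \<open>U\<close> and \<open>P\<close>.\<close>
  then have "sparse_blue [u0] \<and> length [u0] \<le> 2 * inner [u0] + 1"
    by (auto simp: sparse_blue_def path_in_def U_def)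
  then obtain Q where "sparse_blue Q \<and> length Q \<le> 2 * inner Q + 1"
    and Qmax': "\<And>ys. sparse_blue ys \<and> length ys \<le> 2 * inner ys + 1 \<Longrightarrow> length ys \<le> length Q"
    by (rule exists_longest_list[where b = q]) (simp_all add: sparse_blueD(8))
  then have Q: "sparse_blue Q" "length Q \<le> 2 * inner Q + 1" by simp_all
  have Qmax: "length ys \<le> length Q" if "sparse_blue ys" "length ys \<le> 2 * inner ys + 1" for ys
    using Qmax'[of ys] that by simp
  define u where "u = hd Q"
  define W where "W = U - set Q"
  have u: "u \<in> U" "u \<in> V" using sparse_blueD[OF Q(1)] by (auto simp: u_def)
  have W: "W \<subseteq> V" "W \<subseteq> U" "finite W" using finU by (auto simp: W_def)
  have few: "2 * inner Q + 10 * D < q" using none Q by (auto simp: not_le)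
  have cW: "q + 48 * D \<le> 2 * card W + 2 * inner Q + 2"
    using card_outside[OF Q(1)] Q(2) card_U by (simp add: W_def)
  have ext: "\<not> (B u x \<and> B w x)" if "x \<in> set P - set Q" "w \<in> W" for x w
    using sparse_blue_Cons2[OF Q(1), of w x] Qmax[of "w # x # Q"] Q(2) that symB
    by (auto simp: W_def u_def)
  define C where "C = (\<lambda>x x'. consecutive x x' \<and> x \<in> set P - set Q \<and> x' \<in> set P - set Q)"
  \<comment> \<open>If both edges were red, \<open>u\<close> could be inserted into
    \<open>P\<close>. If both were blue, a vertex \<open>w\<close> of \<open>W\<close> adjacent to
    \<open>x\<close> and \<open>x'\<close> would be red to both by \<open>ext\<close> and could be
    inserted instead.\<close>
  have mixed: "R u x \<and> B u x' \<or> R u x' \<and> B u x" if "C x x'" "adj u x" "adj u x'" for x x'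
  proof (rule ccontr)
    assume neg: "\<not> ?thesis"
    have c: "consecutive x x'" "x \<in> set P - set Q" "x' \<in> set P - set Q" using that by (auto simp: C_def)
    have bb: "B u x" "B u x'" using neg that no_red_insert1[OF u(1) c(1)] by (auto simp: adj_def)
    have "length [x, x'] * D < card W" using cW few D_pos by simp
    then obtain w where w: "w \<in> W" "adj x w" "adj x' w"
      using ex_adj_all[OF W(1), of "[x, x']"] c P_props by auto
    then have "R w x" "R w x'" using ext[OF c(2) w(1)] ext[OF c(3) w(1)] bb symB symR by (auto simp: adj_def)
    then show False using no_red_insert1[of w x x'] w W c by auto
  qed
  define X where "X = {x. R u x \<and> (\<exists>x'. C x x' \<and> B u x')}"
  have XP: "X \<subseteq> set P - set Q" by (auto simp: X_def C_def)
  then have finX: "finite X" using finite_subset by blast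
  have blueX: "B x w" if "R u x" "C x x'" "B u x'" "w \<in> W" "adj w x" "adj w x'" for x x' w
  proof -
    have c: "consecutive x x'" "x' \<in> set P - set Q" using that by (auto simp: C_def)
    have "R w x'" using ext[OF c(2) that(4)] that by (auto simp: adj_def)
    then show ?thesis using no_red_insert1[of w x x'] c that W symB by (auto simp: adj_def)
  qed
  have cardX: "length P \<le> 2 * card X + 2 * D + 1 + 2 * inner Q"
  proof -
    let ?N = "\<lambda>d. {i. i + d < length P \<and> \<not> adj u (P ! (i + d))}"
    let ?X = "\<lambda>d. {i. i + d < length P \<and> P ! (i + d) \<in> X}"
    have "i \<in> (?X 0 \<union> ?X 1) \<union> (?N 0 \<union> ?N 1)" if "i \<in> free_pairs Q" for i
    proof (cases "adj u (P ! i) \<and> adj u (P ! (i + 1))")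
      case True
      have "C (P ! i) (P ! (i + 1))" "C (P ! (i + 1)) (P ! i)"
        using that by (auto simp: C_def free_pairs_def consecutive_def)
      with mixed[of "P ! i" "P ! (i + 1)"] True have "P ! i \<in> X \<or> P ! (i + 1) \<in> X"
        by (auto simp: X_def)
      then show ?thesis using that by (auto simp: free_pairs_def)
    qed (use that in \<open>auto simp: free_pairs_def\<close>)
    then have "free_pairs Q \<subseteq> (?X 0 \<union> ?X 1) \<union> (?N 0 \<union> ?N 1)" by blast
    then have "card (free_pairs Q) \<le> card ((?X 0 \<union> ?X 1) \<union> (?N 0 \<union> ?N 1))"
      by (intro card_mono) (simp_all only: finite_idx finite_Un)
    also have "\<dots> \<le> (card (?X 0) + card (?X 1)) + (card (?N 0) + card (?N 1))"
      by (meson card_Un_le add_mono order_trans)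
    finally show ?thesis
      using card_free_pairs[of Q] card_nonadj_idx[OF u(2), of 0] card_nonadj_idx[OF u(2), of 1]
        card_nth_vimage_le[OF P_props(1) finX, of 0] card_nth_vimage_le[OF P_props(1) finX, of 1]
      by linarith
  qed
  \<comment> \<open>The least number of further inner vertices that refutes \<open>none\<close>;
    adding 1 rounds the half up, and by \<open>few\<close> the subtraction is not truncated.\<close>
  define m where "m = (q - 10 * D - 2 * inner Q + 1) div 2"
  have m: "q \<le> 2 * (inner Q + m) + 10 * D" "2 * m \<le> q - 10 * D - 2 * inner Q + 1"
    by (auto simp: m_def)
  have mX: "m + 3 * D \<le> card X" using cardX m few q_le D_pos by linarith
  have mW: "m + 1 + 2 * D \<le> card W" "3 * D < card W" using cW m few D_pos by linarith+
  have degX: "card {w \<in> W. \<not> B w x} \<le> 2 * D" if x: "x \<in> X" for x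
  proof -
    obtain x' where x': "R u x" "C x x'" "B u x'" using x unfolding X_def by blast
    then have V: "x \<in> V" "x' \<in> V" using P_props by (auto simp: C_def)
    have "{w \<in> W. \<not> B w x} \<subseteq> {w \<in> W. \<not> adj x w} \<union> {w \<in> W. \<not> adj x' w}"
      using blueX[OF x'] symB adj_sym by blast
    then have "card {w \<in> W. \<not> B w x} \<le> card ({w \<in> W. \<not> adj x w} \<union> {w \<in> W. \<not> adj x' w})"
      using W by (intro card_mono) auto
    also have "\<dots> \<le> card {w \<in> W. \<not> adj x w} + card {w \<in> W. \<not> adj x' w}" by (rule card_Un_le)
    finally show ?thesis using card_nonadj_le[OF V(1) W(1)] card_nonadj_le[OF V(2) W(1)] by linarith
  qed
  \<comment> \<open>If \<open>x\<close> is not blue to \<open>w\<close>, then \<open>w\<close> is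
    not adjacent to \<open>x\<close> or to its partner \<open>x'\<close>. The first case accounts
    for \<open>D\<close> vertices; in the second, \<open>x\<close> is the successor or predecessor
    on \<open>P\<close> of one of \<open>D\<close> vertices, which gives \<open>2 * D\<close>
    more.\<close>
  have degW: "card {x \<in> X. \<not> B x w} \<le> 3 * D" if "w \<in> W" for w
  proof -
    have wV: "w \<in> V" using that W by auto
    let ?M = "{x \<in> V. \<not> adj w x}"
    let ?I0 = "{i. i + 0 < length P \<and> \<not> adj w (P ! (i + 0))}"
    let ?I1 = "{i. i + 1 < length P \<and> \<not> adj w (P ! (i + 1))}"
    have "x \<in> ?M \<union> ((\<lambda>i. P ! (i + 1)) ` ?I0 \<union> (!) P ` ?I1)" if x: "x \<in> X" "\<not> B x w" for x
    proof -
      obtain x' where x': "R u x" "C x x'" "B u x'" using x(1) unfolding X_def by blast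
      then have "x \<in> V" using P_props by (auto simp: C_def)
      moreover have "\<not> adj w x \<or> \<not> adj w x'" using blueX[OF x' \<open>w \<in> W\<close>] x by blast
      moreover obtain i where "i + 1 < length P" "x = P ! i \<and> x' = P ! (i + 1) \<or> x = P ! (i + 1) \<and> x' = P ! i"
        using x' by (auto simp: C_def consecutive_def)
      ultimately show ?thesis by (auto intro!: imageI)
    qed
    then have "{x \<in> X. \<not> B x w} \<subseteq> ?M \<union> ((\<lambda>i. P ! (i + 1)) ` ?I0 \<union> (!) P ` ?I1)" by blast
    moreover have f: "finite ?I0" "finite ?I1" by (simp_all only: finite_idx)
    ultimately have "card {x \<in> X. \<not> B x w} \<le> card (?M \<union> ((\<lambda>i. P ! (i + 1)) ` ?I0 \<union> (!) P ` ?I1))"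
      using finV by (intro card_mono) auto
    also have "\<dots> \<le> card ?M + (card ((\<lambda>i. P ! (i + 1)) ` ?I0) + card ((!) P ` ?I1))"
      by (meson card_Un_le add_left_mono order_trans)
    finally show ?thesis
      using card_image_le[OF f(1), of "\<lambda>i. P ! (i + 1)"] card_image_le[OF f(2), of "(!) P"]
        card_nonadj_idx[OF wV, of 0] card_nonadj_idx[OF wV, of 1] card_nonadj_le[OF wV subset_refl]
      by linarith
  qed
  have "X \<noteq> {}" using mX D_pos by auto
  then obtain x x' where x: "R u x" "C x x'" "B u x'" by (auto simp: X_def)
  then have xV: "x \<in> V" "x' \<in> V" "x' \<in> set P - set Q" using P_props by (auto simp: C_def)
  obtain w where w: "w \<in> W" "adj u w" "adj x w" "adj x' w"
    using ex_adj_all[OF W(1), of "[u, x, x']"] xV u mW by auto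
  \<comment> \<open>This edge links the new piece to \<open>Q\<close>. Were it red, then
    \<open>u\<close> and \<open>w\<close> would fit between \<open>x\<close> and \<open>x'\<close>,
    as \<open>w\<close> is red to \<open>x'\<close> by \<open>ext\<close>.\<close>
  have uw: "B w u"
  proof (rule ccontr)
    assume "\<not> B w u"
    then have "R u w" using w symB by (auto simp: adj_def)
    moreover have "R w x'" using ext[OF xV(3) w(1)] w x symB symR by (auto simp: adj_def)
    ultimately show False using no_red_insert2[of u w x x'] u w W x by (auto simp: C_def)
  qed
  have disj: "X \<inter> W = {}" using XP by (auto simp: W_def U_def)
  obtain zs where zs: "path_in (\<lambda>x y. B x y \<and> (x \<in> W \<or> y \<in> W)) (X \<union> W) zs" "zs \<noteq> []" "last zs = w"
      "hd zs \<in> W" "card (set zs \<inter> X) = m"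
    using greedy_alternating_path[OF finX W(3) disj w(1), of B "3 * D" "2 * D" m, OF degW degX mX mW(1)]
    by blast
  have "sparse_blue (zs @ Q)"
  proof -
    have "successively (\<lambda>x y. B x y \<and> (x \<in> U \<or> y \<in> U)) zs"
      using zs(1) W(2) by (auto simp: path_in_def elim!: successively_mono)
    moreover have "set zs \<inter> set Q = {}" "set zs \<subseteq> V"
      using zs(1) XP W(1) P_props by (auto simp: path_in_def W_def)
    ultimately show ?thesis
      using zs Q(1) uw W(2) u
      by (auto simp: sparse_blue_def path_in_def successively_append_iff u_def)
  qed
  moreover have "inner (zs @ Q) = m + inner Q"
  proof -
    have "set (zs @ Q) \<inter> set P = (set zs \<inter> X) \<union> (set Q \<inter> set P)"
      using zs(1) XP by (auto simp: path_in_def W_def U_def)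
    moreover have "card \<dots> = card (set zs \<inter> X) + card (set Q \<inter> set P)"
      using XP by (intro card_Un_disjoint) auto
    ultimately show ?thesis using zs by (simp add: inner_def)
  qed
  ultimately show False using none m by auto
qed

section \<open>Longest sparse paths and the alternation they force on \<open>P\<close>\<close>

definition "longest_sparse Q \<longleftrightarrow> sparse_blue Q \<and> q \<le> 2 * inner Q + 10 * D \<and>
  (\<forall>Q'. sparse_blue Q' \<and> q \<le> 2 * inner Q' + 10 * D \<longrightarrow> length Q' \<le> length Q)"

lemma ex_longest_sparse: "\<exists>Q. longest_sparse Q"
proof -
  obtain Q0 where "sparse_blue Q0 \<and> q \<le> 2 * inner Q0 + 10 * D" using ex_sparse_blue_many_inner by blast
  then obtain Q where "sparse_blue Q \<and> q \<le> 2 * inner Q + 10 * D"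
    and "\<And>ys. sparse_blue ys \<and> q \<le> 2 * inner ys + 10 * D \<Longrightarrow> length ys \<le> length Q"
    by (rule exists_longest_list[where b = q]) (simp_all add: sparse_blueD(8))
  then show ?thesis unfolding longest_sparse_def by blast
qed

text \<open>In the form used below, maximality forbids any change that gains a vertex without losing
  inner ones.\<close>

lemma longest_sparseD:
  assumes "longest_sparse Q"
  shows "sparse_blue Q" "q \<le> 2 * inner Q + 10 * D"
    "\<And>Q'. sparse_blue Q' \<Longrightarrow> inner Q \<le> inner Q' \<Longrightarrow> length Q' \<le> length Q"
  using assms by (auto simp: longest_sparse_def)

lemma longest_sparse_same_set:
  assumes "longest_sparse Q" "sparse_blue Q'" "set Q' = set Q" "length Q' = length Q"
  shows "longest_sparse Q'"
  using assms by (auto simp: longest_sparse_def inner_def)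

text \<open>Reversal carries what is shown about the first vertex over to the last one.\<close>

lemma longest_sparse_rev: "longest_sparse Q \<Longrightarrow> longest_sparse (rev Q)"
  by (rule longest_sparse_same_set) (auto dest: longest_sparseD sparse_blue_rev)

context
  fixes Q assumes Q: "longest_sparse Q"
begin

lemma Q_sparse: "sparse_blue Q" using longest_sparseD[OF Q] by simp

lemma hd_Q: "hd Q \<in> U" "hd Q \<in> V" using sparse_blueD[OF Q_sparse] by auto

text \<open>The size of the remainder is \<open>card U + inner Q - length Q\<close>, at least
  \<open>(q / 2 + 24 * D) + (q / 2 - 5 * D) - q\<close>.\<close>

lemma card_W: "19 * D \<le> card (U - set Q)"
  using card_outside[OF Q_sparse] longest_sparseD(2)[OF Q] card_U sparse_blueD(8)[OF Q_sparse] by simp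

lemma W_subset: "U - set Q \<subseteq> V" using finU by auto

lemma hd_not_blue: "w \<in> U - set Q \<Longrightarrow> \<not> B (hd Q) w"
proof
  assume w: "w \<in> U - set Q" "B (hd Q) w"
  then have "sparse_blue (w # Q)" using sparse_blue_Cons[OF Q_sparse] symB by blast
  moreover have "inner Q \<le> inner (w # Q)" unfolding inner_def by (intro card_mono) auto
  ultimately show False using longest_sparseD(3)[OF Q, of "w # Q"] by simp
qed

lemma hd_red: "w \<in> U - set Q \<Longrightarrow> adj (hd Q) w \<Longrightarrow> R (hd Q) w"
  using hd_not_blue by (auto simp: adj_def)

text \<open>Otherwise \<open>w\<close> and \<open>x\<close> could be put in front of
  \<open>Q\<close>.\<close>

lemma no_common_blue:
  assumes "x \<in> set P - set Q" "w \<in> U - set Q" "B (hd Q) x" shows "\<not> B w x"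
proof
  assume "B w x"
  note * = sparse_blue_Cons2[OF Q_sparse assms(2,1) this symB[OF assms(3)]]
  show False using longest_sparseD(3)[OF Q *(1)] *(2) by simp
qed

lemma red_if_blue_hd:
  assumes "x \<in> set P - set Q" "w \<in> U - set Q" "B (hd Q) x" "adj x w" shows "R w x"
  using no_common_blue[OF assms(1-3)] assms(4) symR symB by (auto simp: adj_def)

text \<open>Choose \<open>w\<close> outside \<open>Q\<close> adjacent to all three vertices. It is
  red to \<open>hd Q\<close>, and each of \<open>x\<close> and \<open>x'\<close> is red to
  \<open>hd Q\<close> or, if blue to it, to \<open>w\<close>. Hence one or both of
  \<open>hd Q\<close> and \<open>w\<close> fit between \<open>x\<close> and
  \<open>x'\<close>.\<close>

lemma free_pair_nonadj:
  assumes c: "consecutive x x'" and x: "x \<notin> set Q" "x' \<notin> set Q"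
  shows "\<not> (adj (hd Q) x \<and> adj (hd Q) x')"
proof
  assume a: "adj (hd Q) x \<and> adj (hd Q) x'"
  have P: "x \<in> set P - set Q" "x' \<in> set P - set Q" using consecutive_in_P[OF c] x by auto
  have "set [hd Q, x, x'] \<subseteq> V" using P P_props hd_Q by auto
  moreover have "length [hd Q, x, x'] * D < card (U - set Q)" using card_W D_pos by simp
  ultimately obtain w where w: "w \<in> U - set Q" "adj (hd Q) w" "adj x w" "adj x' w"
    using ex_adj_all[OF W_subset, of "[hd Q, x, x']"] by auto
  have wU: "w \<in> U" using w by simp
  note r = hd_red[OF w(1,2)]
  have bx: "R w x" if "B (hd Q) x" using red_if_blue_hd[OF P(1) w(1) that w(3)] .
  have bx': "R w x'" if "B (hd Q) x'" using red_if_blue_hd[OF P(2) w(1) that w(4)] .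
  show False
    using a bx bx' no_red_insert1[OF hd_Q(1) c] no_red_insert1[OF wU c]
      no_red_insert2[OF hd_Q(1) wU r c] no_red_insert2[OF hd_Q(1) wU r, of x' x] c consecutive_sym
    by (auto simp: adj_def)
qed

lemma card_free_pairs_le: "card (free_pairs Q) \<le> 2 * D"
proof -
  let ?N = "\<lambda>d. {i. i + d < length P \<and> \<not> adj (hd Q) (P ! (i + d))}"
  have "i \<in> ?N 0 \<union> ?N 1" if "i \<in> free_pairs Q" for i
    using free_pair_nonadj[OF consecutive_nth, of i] that by (auto simp: free_pairs_def)
  then have "card (free_pairs Q) \<le> card (?N 0 \<union> ?N 1)"
    by (intro card_mono subsetI) (simp_all only: finite_idx finite_Un)
  also have "\<dots> \<le> card (?N 0) + card (?N 1)" by (rule card_Un_le)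
  finally show ?thesis
    using card_nonadj_idx[OF hd_Q(2), of 0] card_nonadj_idx[OF hd_Q(2), of 1] by linarith
qed

lemma length_P_le: "length P \<le> 2 * inner Q + 2 * D + 1"
  using card_free_pairs[of Q] card_free_pairs_le by linarith

lemma inner_le: "2 * inner Q + 1 \<le> length Q" "length Q \<le> q"
  using sparse_blue_inner[OF Q_sparse] sparse_blueD(8)[OF Q_sparse] by auto

definition "used_pairs = {i. i + 1 < length P \<and> P ! i \<in> set Q \<and> P ! (i + 1) \<in> set Q}"

text \<open>With few free pairs, about \<open>length P - inner Q\<close> pairs enter
  \<open>Q\<close> from outside. At most \<open>inner Q\<close> pairs end in \<open>Q\<close> at
  all, and \<open>2 * inner Q < length P\<close>, so few of them also start there.\<close>

lemma card_used_pairs_le: "card used_pairs \<le> 2 * D"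
proof -
  let ?A = "{i. i + 0 < length P \<and> P ! (i + 0) \<in> set Q}"
  let ?C = "{i. i + 1 < length P \<and> P ! i \<notin> set Q \<and> P ! (i + 1) \<in> set Q}"
  have fin: "finite used_pairs" unfolding used_pairs_def by (rule finite_idx)
  have finC: "finite ?C" by (rule finite_idx)
  have "{..<length P - 1} \<subseteq> ?A \<union> (free_pairs Q \<union> ?C)" by (auto simp: free_pairs_def)
  then have "card {..<length P - 1} \<le> card (?A \<union> (free_pairs Q \<union> ?C))"
    by (intro card_mono) (simp_all only: finite_free_pairs finite_idx finite_Un)
  also have "\<dots> \<le> card ?A + (card (free_pairs Q) + card ?C)"
    by (meson card_Un_le add_left_mono order_trans)
  finally have 1: "length P \<le> 1 + inner Q + 2 * D + card ?C"
    using card_in_idx[of 0 Q] card_free_pairs_le by simp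
  have "card used_pairs + card ?C = card (used_pairs \<union> ?C)"
    using fin finC by (intro card_Un_disjoint[symmetric]) (auto simp: used_pairs_def)
  also have "\<dots> \<le> card {i. i + 1 < length P \<and> P ! (i + 1) \<in> set Q}"
    by (intro card_mono finite_idx) (auto simp: used_pairs_def)
  also have "\<dots> \<le> inner Q" by (rule card_in_idx)
  finally show ?thesis using 1 inner_le q_le by linarith
qed

text \<open>The vertex blue to \<open>hd Q\<close> is red to a suitable \<open>w\<close> outside
  \<open>Q\<close>, and \<open>w\<close> is red to \<open>hd Q\<close>. So \<open>hd Q\<close> and
  \<open>w\<close> would replace \<open>P ! (i + 1)\<close>.\<close>

lemma same_colour:
  assumes "i + 2 < length P" "P ! i \<notin> set Q" "P ! (i + 2) \<notin> set Q"
  shows "\<not> (R (hd Q) (P ! i) \<and> B (hd Q) (P ! (i + 2)))" "\<not> (B (hd Q) (P ! i) \<and> R (hd Q) (P ! (i + 2)))"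
proof -
  have P: "P ! i \<in> set P - set Q" "P ! (i + 2) \<in> set P - set Q" using assms by auto
  have "set [hd Q, P ! i, P ! (i + 2)] \<subseteq> V" using P P_props hd_Q by auto
  moreover have "length [hd Q, P ! i, P ! (i + 2)] * D < card (U - set Q)" using card_W D_pos by simp
  ultimately obtain w where w: "w \<in> U - set Q" "adj (hd Q) w" "adj (P ! i) w" "adj (P ! (i + 2)) w"
    using ex_adj_all[OF W_subset, of "[hd Q, P ! i, P ! (i + 2)]"] by auto
  have wU: "w \<in> U" using w by simp
  note r = hd_red[OF w(1,2)]
  show "\<not> (R (hd Q) (P ! i) \<and> B (hd Q) (P ! (i + 2)))"
    using red_if_blue_hd[OF P(2) w(1) _ w(4)] no_red_replace[OF hd_Q(1) wU r assms(1)] by blast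
  show "\<not> (B (hd Q) (P ! i) \<and> R (hd Q) (P ! (i + 2)))"
    using red_if_blue_hd[OF P(1) w(1) _ w(3)] no_red_replace[OF wU hd_Q(1) symR[OF r] assms(1)] by blast
qed

lemma early_inner_vertex:
  obtains i where "i + 1 < length P" "P ! i \<in> set (take (14 * D) Q)" "P ! (i + 1) \<notin> set Q"
    "adj (hd Q) (P ! (i + 1))"
proof -
  let ?T = "take (14 * D) Q" and ?S = "drop (14 * D) Q"
  note Qs = sparse_blueD[OF Q_sparse]
  have "2 * inner ?S \<le> length ?S"
  proof (cases "?S = []")
    case False
    have "successively (\<lambda>x y. B x y \<and> (x \<in> U \<or> y \<in> U)) ?S"
      using Qs(3) by (rule successively_drop)
    then show ?thesis
      using False Qs by (intro inner_bounds(1)) (auto dest: in_set_dropD)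
  qed (simp add: inner_def)
  moreover have "inner Q = inner ?T + inner ?S"
  proof -
    have "set Q = set ?T \<union> set ?S" by (metis append_take_drop_id set_append)
    then have "set Q \<inter> set P = (set ?T \<inter> set P) \<union> (set ?S \<inter> set P)" by blast
    moreover have "set ?T \<inter> set ?S = {}" using Qs(1) by (intro set_take_disj_set_drop_if_distinct) auto
    ultimately show ?thesis unfolding inner_def by (simp only:) (intro card_Un_disjoint; auto)
  qed
  \<comment> \<open>Here \<open>2 * inner Q\<close> is at least \<open>q - 2 * D - 1\<close> by
    \<open>length_P_le\<close>, while the rest of \<open>Q\<close> has at most
    \<open>q - 14 * D\<close> vertices, at most half of them inner.\<close>
  ultimately have T: "6 * D \<le> inner ?T"
    using length_P_le inner_le q_le q_large longest_sparseD(2)[OF Q] by simp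
  let ?I = "{i. i + 0 < length P \<and> P ! (i + 0) \<in> set ?T}"
  let ?N = "{i. i + 1 < length P \<and> \<not> adj (hd Q) (P ! (i + 1))}"
  have TQ: "set ?T \<subseteq> set Q" by (auto dest: in_set_takeD)
  have cI: "inner ?T \<le> card ?I"
  proof -
    have "set ?T \<inter> set P \<subseteq> (!) P ` ?I" by (fastforce simp: in_set_conv_nth[of _ P])
    then have "card (set ?T \<inter> set P) \<le> card ((!) P ` ?I)" by (intro card_mono finite_imageI finite_idx)
    also have "\<dots> \<le> card ?I" by (intro card_image_le finite_idx)
    finally show ?thesis by (simp add: inner_def)
  qed
  have fin: "finite ({length P - 1} \<union> (used_pairs \<union> ?N))"
    unfolding used_pairs_def by (intro finite_UnI finite_idx) auto
  have "card ({length P - 1} \<union> (used_pairs \<union> ?N)) \<le> card {length P - 1} + (card used_pairs + card ?N)"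
    by (meson card_Un_le add_left_mono order_trans)
  also have "\<dots> \<le> 1 + (2 * D + D)"
    using card_used_pairs_le card_nonadj_idx[OF hd_Q(2), of 1] by simp
  also have "\<dots> < card ?I" using T cI D_pos by simp
  finally have "\<not> ?I \<subseteq> {length P - 1} \<union> (used_pairs \<union> ?N)"
    using card_mono[OF fin, of ?I] by linarith
  then obtain i where "i \<in> ?I" "i \<noteq> length P - 1" "i \<notin> used_pairs" "i \<notin> ?N" by blast
  then show ?thesis using TQ by (intro that[of i]) (auto simp: used_pairs_def)
qed

text \<open>If both are blue, then almost all of \<open>U - set Q\<close> is red to the two vertices, hence blue inside, so
  that a long blue path in it could replace a short initial piece of \<open>Q\<close>. The inner vertices near the
  beginning of \<open>Q\<close> are therefore red to it, which lets \<open>P\<close> be prolonged.\<close>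

lemma not_both_blue:
  assumes i: "i + 2 < length P" "P ! i \<notin> set Q" "P ! (i + 2) \<notin> set Q"
  shows "\<not> (B (hd Q) (P ! i) \<and> B (hd Q) (P ! (i + 2)))"
proof
  assume b: "B (hd Q) (P ! i) \<and> B (hd Q) (P ! (i + 2))"
  have P: "P ! i \<in> set P - set Q" "P ! (i + 2) \<in> set P - set Q" using i by auto
  have PV: "P ! i \<in> V" "P ! (i + 2) \<in> V" using P P_props by auto
  define W where "W = {w \<in> U - set Q. adj (P ! i) w \<and> adj (P ! (i + 2)) w}"
  have WU: "W \<subseteq> U" "W \<subseteq> V" "finite W" "W \<subseteq> U - set Q" using finU by (auto simp: W_def)
  have cardW: "17 * D \<le> card W"
  proof -
    let ?N = "\<lambda>v. {w \<in> U - set Q. \<not> adj v w}"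
    have "U - set Q = W \<union> (?N (P ! i) \<union> ?N (P ! (i + 2)))" by (auto simp: W_def)
    then have "card (U - set Q) = card (W \<union> (?N (P ! i) \<union> ?N (P ! (i + 2))))" by (rule arg_cong)
    also have "\<dots> \<le> card W + (card (?N (P ! i)) + card (?N (P ! (i + 2))))"
      by (meson card_Un_le add_left_mono order_trans)
    finally show ?thesis
      using card_nonadj_le[OF PV(1) W_subset] card_nonadj_le[OF PV(2) W_subset] card_W by linarith
  qed
  have redW: "R w (P ! i)" "R w (P ! (i + 2))" if "w \<in> W" for w
    using red_if_blue_hd[OF P(1), of w] red_if_blue_hd[OF P(2), of w] b that by (auto simp: W_def)
  \<comment> \<open>All of \<open>W\<close> is red to \<open>P ! i\<close> and
    \<open>P ! (i + 2)\<close>, so a red edge within \<open>W\<close> could replace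
    \<open>P ! (i + 1)\<close>.\<close>
  have blueW: "B w w'" if "w \<in> W" "w' \<in> W" "adj w w'" for w w'
    using no_red_replace[of w w' i] redW that WU i by (auto simp: adj_def)
  have early: "\<not> B v w" if v: "v \<in> set (take (14 * D) Q)" and w: "w \<in> W" for v w
  proof
    assume vw: "B v w"
    obtain j where j: "j < 14 * D" "j < length Q" "v = Q ! j"
      using v by (auto simp: in_set_conv_nth)
    have "card {y \<in> W. y \<noteq> x \<and> \<not> B y x} \<le> D" if "x \<in> W" for x
    proof -
      have "{y \<in> W. y \<noteq> x \<and> \<not> B y x} \<subseteq> {y \<in> W. \<not> adj x y}" using blueW that symB by blast
      then have "card {y \<in> W. y \<noteq> x \<and> \<not> B y x} \<le> card {y \<in> W. \<not> adj x y}"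
        using WU by (intro card_mono) auto
      then show ?thesis using card_nonadj_le[of x W] that WU by auto
    qed
    then obtain zs where zs: "path_in B W zs" "length zs = 16 * D" "last zs = w"
      using greedy_path[OF WU(3) w, of B D "16 * D"] cardW D_pos by auto
    have "successively B Q" using sparse_blueD(3)[OF Q_sparse] by (rule successively_mono) auto
    then have "successively B (drop j Q)" by (rule successively_drop)
    moreover have "set (drop j Q) \<subseteq> set Q" by (auto dest: in_set_dropD)
    ultimately have "path_in B V (zs @ drop j Q)"
      using zs vw j WU sparse_blueD(1,2)[OF Q_sparse] symB
      by (auto simp: path_in_def successively_append_iff hd_drop_conv_nth)
    \<comment> \<open>Fewer than \<open>14 * D\<close> vertices of \<open>Q\<close> give way to
      \<open>16 * D\<close> new ones, and \<open>length Q\<close> is at least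
      \<open>q - 2 * D\<close>. The comparison is with \<open>q\<close>, not with \<open>Q\<close>,
      because inner vertices may have been lost.\<close>
    from blue_le[OF this] show False
      using zs j length_P_le inner_le q_le by simp
  qed
  obtain j where j: "j + 1 < length P" "P ! j \<in> set (take (14 * D) Q)" "P ! (j + 1) \<notin> set Q"
      "adj (hd Q) (P ! (j + 1))" by (rule early_inner_vertex)
  have c: "consecutive (P ! j) (P ! (j + 1))" using j by (intro consecutive_nth)
  have P': "P ! (j + 1) \<in> set P - set Q" using j by auto
  have "set [hd Q, P ! j, P ! (j + 1)] \<subseteq> V" using hd_Q nth_P_in j by auto
  moreover have "length [hd Q, P ! j, P ! (j + 1)] * D < card W" using cardW D_pos by simp
  ultimately obtain w where w: "w \<in> W" "adj (hd Q) w" "adj (P ! j) w" "adj (P ! (j + 1)) w"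
    using ex_adj_all[OF WU(2), of "[hd Q, P ! j, P ! (j + 1)]"] by auto
  have wU: "w \<in> U" "w \<in> U - set Q" using w WU by auto
  have rj: "R w (P ! j)" using early[OF j(2) w(1)] w symR by (auto simp: adj_def)
  note r = hd_red[OF wU(2) w(2)]
  \<comment> \<open>If \<open>P ! (j + 1)\<close> is red to \<open>hd Q\<close>, then
    \<open>w\<close> and \<open>hd Q\<close> fit in behind \<open>P ! j\<close>; if it is blue to
    \<open>hd Q\<close>, it is red to \<open>w\<close>, which fits in alone.\<close>
  show False
    using rj no_red_insert1[OF wU(1) c] no_red_insert2[OF wU(1) hd_Q(1) symR[OF r] c]
      red_if_blue_hd[OF P' wU(2) _ w(4)] j by (auto simp: adj_def)
qed

definition "free_gaps = {i. i + 2 < length P \<and> P ! i \<notin> set Q \<and> P ! (i + 2) \<notin> set Q}"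

lemma both_red:
  assumes "i \<in> free_gaps" "adj (hd Q) (P ! i)" "adj (hd Q) (P ! (i + 2))"
  shows "R (hd Q) (P ! i)" "R (hd Q) (P ! (i + 2))"
  using same_colour[of i] not_both_blue[of i] assms unfolding free_gaps_def adj_def by blast+

text \<open>A failing position has \<open>P ! i\<close> on \<open>Q\<close>, or is a free pair, or
  is followed by a used pair. Fewer than half of the positions are of the first type and at most
  \<open>4 * D\<close> of the others.\<close>

lemma card_free_gaps: "15 * D \<le> card free_gaps"
proof -
  let ?A = "{i. i + 0 < length P \<and> P ! (i + 0) \<in> set Q}"
  let ?C = "{i. i + 1 < length P \<and> i + 1 \<in> used_pairs}"
  have "{..<length P - 2} \<subseteq> free_gaps \<union> (?A \<union> (free_pairs Q \<union> ?C))"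
    by (auto simp: free_gaps_def free_pairs_def used_pairs_def)
  then have "card {..<length P - 2} \<le> card (free_gaps \<union> (?A \<union> (free_pairs Q \<union> ?C)))"
    unfolding free_gaps_def by (intro card_mono) (simp_all only: finite_free_pairs finite_idx finite_Un)
  also have "\<dots> \<le> card free_gaps + (card ?A + (card (free_pairs Q) + card ?C))"
    by (meson card_Un_le add_left_mono order_trans)
  also have "card ?C \<le> card used_pairs"
    by (rule card_inj_on_le[of "\<lambda>i. i + 1"]) (auto simp: used_pairs_def finite_idx[of 1, simplified])
  finally show ?thesis
    using card_in_idx[of 0 Q] card_free_pairs_le card_used_pairs_le inner_le q_le q_large D_pos by simp
qed

text \<open>The middle vertices \<open>P ! (i + 1)\<close> are the pivots at which \<open>Q\<close>
  can be rotated.\<close>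

definition "good_gaps = {i \<in> free_gaps. P ! (i + 1) \<in> set Q \<and>
  R (hd Q) (P ! i) \<and> B (hd Q) (P ! (i + 1))}"

lemma card_good_gaps: "10 * D \<le> card good_gaps"
proof -
  let ?N = "\<lambda>d. {i. i + d < length P \<and> \<not> adj (hd Q) (P ! (i + d))}"
  have "i \<in> good_gaps \<union> (free_pairs Q \<union> (?N 0 \<union> (?N 1 \<union> ?N 2)))" if i: "i \<in> free_gaps" for i
  proof (cases "i \<in> free_pairs Q \<union> (?N 0 \<union> (?N 1 \<union> ?N 2))")
    case False
    have l: "i + 2 < length P" using i by (simp add: free_gaps_def)
    have a: "adj (hd Q) (P ! i)" "adj (hd Q) (P ! (i + 1))" "adj (hd Q) (P ! (i + 2))"
      using False l by auto
    note r = both_red(1)[OF i a(1,3)]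
    have "consecutive (P ! i) (P ! (i + 1))" using l by (intro consecutive_nth) simp
    then have "B (hd Q) (P ! (i + 1))" using no_red_insert1[OF hd_Q(1)] r a by (auto simp: adj_def)
    then show ?thesis using i r False l by (auto simp: good_gaps_def free_gaps_def free_pairs_def)
  qed blast
  then have "free_gaps \<subseteq> good_gaps \<union> (free_pairs Q \<union> (?N 0 \<union> (?N 1 \<union> ?N 2)))" by blast
  moreover have "finite good_gaps" by (rule finite_subset[OF _ finite_idx[of 2 "\<lambda>_. True"]]) (auto simp: good_gaps_def free_gaps_def)
  ultimately have "card free_gaps \<le> card (good_gaps \<union> (free_pairs Q \<union> (?N 0 \<union> (?N 1 \<union> ?N 2))))"
    by (intro card_mono) (simp_all only: finite_free_pairs finite_idx finite_Un)
  also have "\<dots> \<le> card good_gaps + (card (free_pairs Q) + (card (?N 0) + (card (?N 1) + card (?N 2))))"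
    by (meson card_Un_le add_left_mono order_trans)
  finally show ?thesis
    using card_nonadj_idx[OF hd_Q(2), of 0] card_nonadj_idx[OF hd_Q(2), of 1]
      card_nonadj_idx[OF hd_Q(2), of 2] card_free_pairs_le card_free_gaps by linarith
qed

text \<open>A Posa rotation: the edge from \<open>hd Q\<close> to \<open>Q ! (j + 1)\<close>
  replaces the one from \<open>Q ! j\<close>, and the initial piece is reversed. The new first
  vertex lies in \<open>U\<close> because its old successor does not.\<close>

lemma rotate_sparse:
  assumes j: "j + 1 < length Q" "B (hd Q) (Q ! (j + 1))" "Q ! (j + 1) \<notin> U"
  shows "\<exists>Q'. longest_sparse Q' \<and> hd Q' = Q ! j \<and> last Q' = last Q"
proof -
  note Qs = sparse_blueD[OF Q_sparse]
  let ?Q = "rev (take (j + 1) Q) @ drop (j + 1) Q"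
  have ne: "take (j + 1) Q \<noteq> []" "drop (j + 1) Q \<noteq> []" using j by auto
  have e: "last (take (j + 1) Q) = Q ! j" "hd (drop (j + 1) Q) = Q ! (j + 1)"
    "hd (take (j + 1) Q) = hd Q" "last (drop (j + 1) Q) = last Q"
    using j by (simp add: take_Suc_conv_app_nth, simp add: hd_drop_conv_nth, simp_all)
  have s: "successively (\<lambda>x y. B x y \<and> (x \<in> U \<or> y \<in> U)) (take (j + 1) Q)"
    "successively (\<lambda>x y. B x y \<and> (x \<in> U \<or> y \<in> U)) (drop (j + 1) Q)"
    "B (Q ! j) (Q ! (j + 1)) \<and> (Q ! j \<in> U \<or> Q ! (j + 1) \<in> U)"
    using successively_take[OF Qs(3)] successively_drop[OF Qs(3)] Qs(3) j(1)
    by (simp_all add: successively_conv_nth[of _ Q])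
  have s': "successively (\<lambda>x y. B x y \<and> (x \<in> U \<or> y \<in> U)) (rev (take (j + 1) Q))"
    using s(1) symB unfolding successively_rev by (auto elim!: successively_mono)
  have set: "set ?Q = set Q" by (metis append_take_drop_id set_append set_rev)
  have len: "length ?Q = length Q" using j by simp
  have "distinct ?Q" using set len Qs(1) by (metis card_distinct distinct_card)
  moreover have hd: "hd ?Q = Q ! j" "last ?Q = last Q" using ne e by (auto simp: hd_rev hd_append)
  moreover have "successively (\<lambda>x y. B x y \<and> (x \<in> U \<or> y \<in> U)) ?Q"
    unfolding successively_append_iff using s' s(2) j hd_Q e by (auto simp: last_rev)
  ultimately have "sparse_blue ?Q"
    using set Qs(2,6) s(3) j ne by (auto simp: sparse_blue_def path_in_def)
  then show ?thesis using longest_sparse_same_set[OF Q] set len hd by blast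
qed

end

section \<open>The two ends of a longest sparse path\<close>

lemma ex_longest_sparse_adj_ends: "\<exists>Q. longest_sparse Q \<and> adj (hd Q) (last Q)"
proof -
  obtain Q where Q: "longest_sparse Q" using ex_longest_sparse by blast
  note Qs = sparse_blueD[OF Q_sparse[OF Q]]
  let ?G = "good_gaps Q"
  \<comment> \<open>The positions just before a pivot, hence the possible new first vertices. There
    are at least \<open>10 * D\<close> of them, too many for all to be non-adjacent to
    \<open>last Q\<close>.\<close>
  define J where "J = {j. j + 1 < length Q \<and> Q ! (j + 1) \<in> (\<lambda>i. P ! (i + 1)) ` ?G}"
  have G: "i + 2 < length P" "P ! (i + 1) \<in> set Q" "B (hd Q) (P ! (i + 1))" if "i \<in> ?G" for i
    using that by (auto simp: good_gaps_def[OF Q] free_gaps_def[OF Q])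
  have finJ: "finite J" by (rule finite_subset[of _ "{..<length Q}"]) (auto simp: J_def)
  have "(\<lambda>i. P ! (i + 1)) ` ?G \<subseteq> (\<lambda>j. Q ! (j + 1)) ` J"
  proof
    fix b assume b: "b \<in> (\<lambda>i. P ! (i + 1)) ` ?G"
    then have "b \<in> set Q" "b \<notin> U" using G nth_P_in(2) by fastforce+
    then obtain k where k: "k < length Q" "Q ! k = b" by (auto simp: in_set_conv_nth)
    \<comment> \<open>A pivot lies in \<open>P\<close>, whereas \<open>Q\<close> starts in
      \<open>U\<close>; so every pivot has a predecessor on \<open>Q\<close>.\<close>
    have "k \<noteq> 0" using k \<open>b \<notin> U\<close> Qs(4,5) by (metis hd_conv_nth)
    then obtain j where "k = j + 1" by (metis Suc_eq_plus1 not0_implies_Suc)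
    then show "b \<in> (\<lambda>j. Q ! (j + 1)) ` J" using k b by (auto simp: J_def)
  qed
  then have "card ((\<lambda>i. P ! (i + 1)) ` ?G) \<le> card ((\<lambda>j. Q ! (j + 1)) ` J)"
    using finJ by (intro card_mono) auto
  also have "\<dots> \<le> card J" using finJ by (rule card_image_le)
  also have "card J = card ((!) Q ` J)"
    using Qs(1) by (intro card_image[symmetric]) (auto simp: inj_on_def J_def nth_eq_iff_index_eq)
  also have "card ((\<lambda>i. P ! (i + 1)) ` ?G) = card ?G"
  proof (intro card_image inj_onI)
    fix i i' assume "i \<in> ?G" "i' \<in> ?G" "P ! (i + 1) = P ! (i' + 1)"
    then show "i = i'"
      using G(1)[of i] G(1)[of i'] nth_eq_iff_index_eq[OF P_props(1), of "i + 1" "i' + 1"] by simp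
  qed
  finally have "card ?G \<le> card ((!) Q ` J)" .
  then have "length [last Q] * D < card ((!) Q ` J)"
    using card_good_gaps[OF Q] D_pos by simp
  moreover have "(!) Q ` J \<subseteq> V" using Qs(2) by (auto simp: J_def)
  moreover have "set [last Q] \<subseteq> V" using Qs(2,4) by auto
  ultimately have "\<exists>y\<in>(!) Q ` J. \<forall>v\<in>set [last Q]. adj v y" by (intro ex_adj_all)
  then obtain j where j: "j \<in> J" "adj (last Q) (Q ! j)" by auto
  then obtain i where "j + 1 < length Q" "i \<in> ?G" "Q ! (j + 1) = P ! (i + 1)" by (auto simp: J_def)
  then have "\<exists>Q'. longest_sparse Q' \<and> hd Q' = Q ! j \<and> last Q' = last Q"
    using G[of i] nth_P_in(2)[of "i + 1"] by (intro rotate_sparse[OF Q]) simp_all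
  then show ?thesis using j(2) adj_sym by metis
qed

text \<open>Apart from at most \<open>4 * D\<close> exceptions, both ends are red to both sides of a
  free gap, since \<open>free_gaps\<close> depends on \<open>set Q\<close> only. The two ends would
  then replace the middle vertex.\<close>

lemma ends_not_red:
  assumes Q: "longest_sparse Q" shows "\<not> R (hd Q) (last Q)"
proof
  assume r: "R (hd Q) (last Q)"
  note Q' = longest_sparse_rev[OF Q]
  have ne: "Q \<noteq> []" using sparse_blueD[OF Q_sparse[OF Q]] by simp
  then have h: "hd (rev Q) = last Q" by (simp add: hd_rev)
  let ?N = "\<lambda>v d. {i. i + d < length P \<and> \<not> adj v (P ! (i + d))}"
  let ?F = "(?N (hd Q) 0 \<union> ?N (hd Q) 2) \<union> (?N (last Q) 0 \<union> ?N (last Q) 2)"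
  note n = card_nonadj_idx[OF hd_Q(2)[OF Q]] card_nonadj_idx[OF hd_Q(2)[OF Q'], unfolded h]
  have "card ?F \<le> (card (?N (hd Q) 0) + card (?N (hd Q) 2)) + (card (?N (last Q) 0) + card (?N (last Q) 2))"
    by (meson card_Un_le add_mono order_trans)
  also have "\<dots> < card (free_gaps Q)"
    using n(1)[of 0] n(1)[of 2] n(2)[of 0] n(2)[of 2] card_free_gaps[OF Q] D_pos by linarith
  finally have "\<not> free_gaps Q \<subseteq> ?F"
    using card_mono[of ?F "free_gaps Q", OF finite_UnI[OF finite_UnI finite_UnI, OF finite_idx finite_idx finite_idx finite_idx]]
    by linarith
  then obtain i where i: "i \<in> free_gaps Q" "i \<notin> ?F" by blast
  then have l: "i + 2 < length P" by (simp add: free_gaps_def[OF Q])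
  have i': "i \<in> free_gaps (rev Q)" using i by (simp add: free_gaps_def[OF Q] free_gaps_def[OF Q'])
  have "R (hd Q) (P ! i)" using both_red(1)[OF Q i(1)] i l by auto
  moreover have "R (last Q) (P ! (i + 2))" using both_red(2)[OF Q' i', unfolded h] i l by auto
  ultimately show False using no_red_replace[OF hd_Q(1)[OF Q] hd_Q(1)[OF Q', unfolded h] r l] by blast
qed

text \<open>A blue edge between the ends closes \<open>Q\<close> to a cycle, which can be opened at any inner vertex.\<close>

lemma ends_not_blue:
  assumes Q: "longest_sparse Q" shows "\<not> B (hd Q) (last Q)"
proof
  assume bl: "B (hd Q) (last Q)"
  note Qs = sparse_blueD[OF Q_sparse[OF Q]]
  have "0 < card (good_gaps Q)" using card_good_gaps[OF Q] D_pos by simp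
  then obtain i where "i \<in> good_gaps Q" by fastforce
  then have i: "i + 2 < length P" "P ! (i + 1) \<in> set Q" "R (hd Q) (P ! i)"
    by (auto simp: good_gaps_def[OF Q] free_gaps_def[OF Q])
  define b where "b = P ! (i + 1)"
  have b: "b \<in> set Q" "b \<notin> U" "b \<in> V" using i nth_P_in[of "i + 1"] by (auto simp: b_def)
  have "set [hd Q, b] \<subseteq> V" using hd_Q[OF Q] b by auto
  moreover have "length [hd Q, b] * D < card (U - set Q)" using card_W[OF Q] D_pos by simp
  ultimately obtain w where w: "w \<in> U - set Q" "adj (hd Q) w" "adj b w"
    using ex_adj_all[OF W_subset[OF Q], of "[hd Q, b]"] by auto
  have wU: "w \<in> U" using w by simp
  have c: "consecutive (P ! i) b" unfolding b_def using i by (intro consecutive_nth) simp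
  have "\<not> B w b"
  proof
    assume wb: "B w b"
    obtain xs zs where Qd: "Q = xs @ b # zs" using b by (auto simp: in_set_conv_decomp)
    have ne: "xs \<noteq> []" "zs \<noteq> []" using Qs(5,6) b Qd by auto
    \<comment> \<open>From \<open>b\<close> back to \<open>hd Q\<close>, across the closing edge to
      \<open>last Q\<close>, and back to the successor of \<open>b\<close>: all of \<open>Q\<close>
      preceded by \<open>w\<close>.\<close>
    let ?Q = "w # b # rev xs @ rev zs"
    let ?E = "\<lambda>x y. B x y \<and> (x \<in> U \<or> y \<in> U)"
    have s: "successively ?E xs" "successively ?E zs" "?E (last xs) b" "?E b (hd zs)"
      using Qs(3) ne by (auto simp: Qd successively_append_iff successively_Cons)
    have s': "successively ?E (rev xs)" "successively ?E (rev zs)"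
      using s(1,2) symB unfolding successively_rev by (auto elim!: successively_mono)
    have ends: "hd Q = hd xs" "last Q = last zs" using ne by (auto simp: Qd)
    have "successively ?E ?Q"
      using s s' ne bl ends hd_Q(1)[OF Q] wb wU symB
      by (auto simp: successively_append_iff successively_Cons hd_rev last_rev hd_append)
    moreover have "distinct ?Q" "set ?Q \<subseteq> V" using Qs(1,2) w finU by (auto simp: Qd)
    moreover have "last ?Q \<in> U" using ne s(4) b by (simp add: last_rev)
    ultimately have "sparse_blue ?Q" using wU by (simp add: sparse_blue_def path_in_def)
    moreover have "inner Q \<le> inner ?Q" unfolding inner_def by (intro card_mono) (auto simp: Qd)
    ultimately show False using longest_sparseD(3)[OF Q, of ?Q] by (simp add: Qd)
  qed
  then have "R w b" using w symB symR by (auto simp: adj_def)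
  \<comment> \<open>Now \<open>hd Q\<close> and \<open>w\<close> fit between \<open>P ! i\<close>
    and \<open>b\<close>.\<close>
  then show False using no_red_insert2[OF hd_Q(1)[OF Q] wU hd_red[OF Q w(1,2)] c] i by blast
qed

lemma contradiction: False
  using ex_longest_sparse_adj_ends ends_not_red ends_not_blue by (auto simp: adj_def)

end

section \<open>From longest paths back to graphs and to \<epsilon>\<close>

lemma card_lt_if_paths_bounded:
  assumes rb: "two_coloured V R B D" and br: "two_coloured V B R D"
    and red: "\<And>xs. path_in R V xs \<Longrightarrow> length xs \<le> k"
    and blue: "\<And>xs. path_in B V xs \<Longrightarrow> length xs \<le> l"
    and "l \<le> k"
  shows "2 * card V < 2 * k + l + 48 * D"
proof (rule ccontr)
  assume "\<not> ?thesis"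
  then have large: "2 * k + l + 48 * D \<le> 2 * card V" by simp
  have "path_in R V []" "path_in B V []" by (auto simp: path_in_def)
  then obtain P Q where P: "path_in R V P" "\<And>xs. path_in R V xs \<Longrightarrow> length xs \<le> length P"
    and Q: "path_in B V Q" "\<And>xs. path_in B V xs \<Longrightarrow> length xs \<le> length Q"
    using exists_longest_list[of "path_in R V" "[]" k] exists_longest_list[of "path_in B V" "[]" l] red blue
    by metis
  note le = red[OF P(1)] blue[OF Q(1)]
  show False
  \<comment> \<open>The longer path has to play the part of \<open>P\<close>. If it is the blue one,
    the colours are exchanged, and \<open>l \<le> k\<close> preserves the size condition.\<close>
  proof (cases "length Q \<le> length P")
    case True
    have "extremal_colouring V R B D P (length Q)"
      using rb P Q True large le by (intro extremal_colouring.intro extremal_colouring_axioms.intro) auto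
    then show False by (rule extremal_colouring.contradiction)
  next
    case False
    have "extremal_colouring V B R D Q (length P)"
      using br P Q False large le \<open>l \<le> k\<close>
      by (intro extremal_colouring.intro extremal_colouring_axioms.intro) auto
    then show False by (rule extremal_colouring.contradiction)
  qed
qed

lemma contains_path_graph:
  assumes "path_in (\<lambda>x y. {x, y} \<in> edges H) (verts H) xs" "m \<le> length xs"
  shows "contains_copy H (path_graph m)"
proof -
  have xs: "distinct xs" "set xs \<subseteq> verts H" "successively (\<lambda>x y. {x, y} \<in> edges H) xs"
    using assms by (auto simp: path_in_def)
  have "inj_on ((!) xs) {..<m}" using xs(1) assms(2) by (auto simp: inj_on_def nth_eq_iff_index_eq)
  moreover have "(!) xs ` {..<m} \<subseteq> verts H" using xs(2) assms(2) by (auto simp: subset_iff)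
  moreover have "(!) xs ` e \<in> edges H" if "e \<in> {{i, Suc i} |i. Suc i < m}" for e
    using that xs(3) assms(2) by (auto simp: successively_conv_nth)
  ultimately show ?thesis unfolding contains_copy_def path_graph_def by auto
qed

lemma card_nonneighbours:
  assumes G: "simple_graph G" and v: "v \<in> verts G"
  shows "card {x \<in> verts G. {v, x} \<notin> edges G} + degree G v = card (verts G)"
proof -
  have fin: "finite (verts G)" using G by (simp add: simple_graph_def)
  let ?N = "{x \<in> verts G. {v, x} \<in> edges G}"
  have "bij_betw (\<lambda>x. {v, x}) ?N {e \<in> edges G. v \<in> e}"
  proof (rule bij_betw_imageI)
    show "inj_on (\<lambda>x. {v, x}) ?N" by (auto simp: inj_on_def doubleton_eq_iff)
    have "e \<in> (\<lambda>x. {v, x}) ` ?N" if e: "e \<in> edges G" "v \<in> e" for e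
    proof -
      have "card e = 2" "e \<subseteq> verts G" using G e by (auto simp: simple_graph_def)
      then obtain x where "e = {v, x}" using e(2) by (auto simp: card_2_iff)
      then show ?thesis using e \<open>e \<subseteq> verts G\<close> by auto
    qed
    then show "(\<lambda>x. {v, x}) ` ?N = {e \<in> edges G. v \<in> e}" by blast
  qed
  then have "degree G v = card ?N" by (simp add: degree_def bij_betw_same_card)
  moreover have "card {x \<in> verts G. {v, x} \<notin> edges G} + card ?N = card (verts G)"
    using fin by (subst card_Un_disjoint[symmetric]) (auto intro: arg_cong[of _ _ card])
  ultimately show ?thesis by simp
qed

text \<open>It suffices that \<open>n\<close> is at most \<open>5 / 2 * k\<close>. For small
  \<epsilon> this follows from the upper bound on \<open>n\<close>, the summand 1 being absorbed by
  \<open>\<epsilon> * n\<close>.\<close>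

lemma vertex_count_slack:
  fixes \<epsilon> k n :: real
  assumes eps: "0 < \<epsilon>" "\<epsilon> < 1 / 4" and k: "1 \<le> k"
    and n: "1 + k + 60 * \<epsilon> * k \<le> n" "1 \<le> \<epsilon> * n" "n \<le> 2 * k + 2 * (\<epsilon> * n) + 1"
  shows "24 * (\<epsilon> * n) \<le> 60 * \<epsilon> * k"
proof -
  have "n \<le> 5 / 2 * k"
  proof (rule ccontr)
    assume c: "\<not> ?thesis"
    show False
    proof (cases "\<epsilon> < 1 / 20")
      case True
      have "0 < n" using n(1) eps k by (smt (verit) mult_nonneg_nonneg)
      then have "\<epsilon> * n < 1 / 20 * n" using True by (intro mult_strict_right_mono)
      then show False using n c by linarith
    next
      \<comment> \<open>For \<epsilon> from 1/20 up to 1/4 the lower and upper bounds on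
        \<open>n\<close> contradict each other: they would give
        \<open>28 * \<epsilon> - 1 \<le> 2 * \<epsilon>\<close>.\<close>
      case False
      have "(1 - 2 * \<epsilon>) * (1 + k + 60 * \<epsilon> * k) \<le> (1 - 2 * \<epsilon>) * n"
        using eps n(1) by (intro mult_left_mono) auto
      also have "\<dots> \<le> 2 * k + 1" using n(3) by (simp add: algebra_simps)
      finally have 1: "k * (58 * \<epsilon> - 120 * \<epsilon>\<^sup>2 - 1) \<le> 2 * \<epsilon>"
        by (simp add: algebra_simps power2_eq_square)
      have "\<epsilon> * \<epsilon> \<le> 1 / 4 * \<epsilon>" using eps by (intro mult_right_mono) auto
      then have 2: "28 * \<epsilon> - 1 \<le> 58 * \<epsilon> - 120 * \<epsilon>\<^sup>2 - 1" by (simp add: power2_eq_square)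
      then have 3: "1 * (58 * \<epsilon> - 120 * \<epsilon>\<^sup>2 - 1) \<le> k * (58 * \<epsilon> - 120 * \<epsilon>\<^sup>2 - 1)"
        using False k by (intro mult_right_mono) auto
      then show False using 1 2 3[unfolded mult_1] False by linarith
    qed
  qed
  then have "\<epsilon> * n \<le> \<epsilon> * (5 / 2 * k)" using eps by (intro mult_left_mono) auto
  then show ?thesis by simp
qed

theorem theorem1p3:
  fixes \<epsilon> :: real and k l n :: nat and G :: "'a ugraph"
  assumes "0 < \<epsilon>" and "\<epsilon> < 1 / 4"
    and "1 \<le> l" and "l \<le> k"
    and "simple_graph G" and "card (verts G) = n"
    and "real n \<ge> real k + real_of_int \<lfloor>(real l + 1) / 2\<rfloor> + 60 * \<epsilon> * real k"
    and "real (min_degree G) \<ge> (1 - \<epsilon>) * real n"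
  shows "arrows G (path_graph (k + 1)) (path_graph (l + 1))"
proof (rule ccontr)
  assume "\<not> ?thesis"
  then obtain c where no: "\<not> contains_copy (colour_subgraph G c Red) (path_graph (k + 1))"
      "\<not> contains_copy (colour_subgraph G c Blue) (path_graph (l + 1))"
    by (auto simp: arrows_def)
  define E where "E = (\<lambda>a x y. {x, y} \<in> edges G \<and> c {x, y} = a)"
  have bound: "length xs \<le> m"
    if "\<not> contains_copy (colour_subgraph G c a) (path_graph (m + 1))" "path_in (E a) (verts G) xs" for a m xs
    using contains_path_graph[of "colour_subgraph G c a" xs "m + 1"] that
    by (fastforce simp: colour_subgraph_def E_def)
  note red = bound[OF no(1)] and blue = bound[OF no(2)]
  define D where "D = nat \<lfloor>\<epsilon> * real n\<rfloor>"
  have fin: "finite (verts G)" using assms by (simp add: simple_graph_def)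
  have "\<lfloor>(real l + 1) / 2\<rfloor> = (int l + 1) div 2"
    using floor_divide_of_int_eq[of "int l + 1" 2, where 'a = real] by simp
  then have "2 * \<lfloor>(real l + 1) / 2\<rfloor> \<ge> int l" by presburger
  then have l_half: "real l / 2 \<le> real_of_int \<lfloor>(real l + 1) / 2\<rfloor>" by linarith
  have "1 \<le> \<lfloor>(real l + 1) / 2\<rfloor>" using assms(3) by (simp add: le_floor_iff)
  then have n1: "1 + real k + 60 * \<epsilon> * real k \<le> real n" using assms(7) by linarith
  have few: "card {x \<in> verts G. {v, x} \<notin> edges G} \<le> D" if v: "v \<in> verts G" for v
  proof -
    have "min_degree G \<le> degree G v" using fin v by (simp add: min_degree_def)
    then have "(1 - \<epsilon>) * real n \<le> real (degree G v)" using assms(8) by linarith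
    moreover have "real (card {x \<in> verts G. {v, x} \<notin> edges G}) + real (degree G v) = real n"
      using card_nonneighbours[OF assms(5) v] assms(6) by linarith
    ultimately have "real (card {x \<in> verts G. {v, x} \<notin> edges G}) \<le> \<epsilon> * real n"
      by (simp add: algebra_simps)
    then show ?thesis unfolding D_def by linarith
  qed
  have loop: "{x, x} \<notin> edges G" for x
    using assms(5) by (auto simp: simple_graph_def)
  have "0 < real n" using n1 assms(1) by (smt (verit) mult_nonneg_nonneg of_nat_0_le_iff)
  then have "0 < card (verts G)" using assms(6) by simp
  then obtain v where v: "v \<in> verts G" by fastforce
  \<comment> \<open>Without loops, \<open>v\<close> is one of its own non-neighbours.\<close>
  have "card {v} \<le> card {x \<in> verts G. {v, x} \<notin> edges G}"
    using fin v loop by (intro card_mono) auto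
  with few[OF v] have D1: "1 \<le> D" by simp
  have Dle: "real D \<le> \<epsilon> * real n" using \<open>0 < real n\<close> assms(1) by (simp add: D_def)
  have col: "two_coloured (verts G) (E a) (E b) D" if "{a, b} = {Red, Blue}" for a b
  proof
    fix v assume v: "v \<in> verts G"
    have "c e = a \<or> c e = b" for e using that by (cases "c e") (auto simp: doubleton_eq_iff)
    then have "{x \<in> verts G. \<not> (E a v x \<or> E b v x)} = {x \<in> verts G. {v, x} \<notin> edges G}"
      by (auto simp: E_def)
    then show "card {x \<in> verts G. \<not> (E a v x \<or> E b v x)} \<le> D" using few[OF v] by simp
  qed (use fin loop D1 in \<open>auto simp: E_def insert_commute\<close>)
  have rb: "two_coloured (verts G) (E Red) (E Blue) D" and br: "two_coloured (verts G) (E Blue) (E Red) D"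
    by (auto intro!: col)
  \<comment> \<open>This crude bound only serves to make \<open>60 * \<epsilon> * k\<close> worth at
    least \<open>24 * D\<close>.\<close>
  have "n \<le> k + l + 2 * D + 1"
    using two_coloured.card_le_longest_paths[OF rb red blue] assms(6) by simp
  then have "real n \<le> 2 * real k + 2 * (\<epsilon> * real n) + 1" using Dle assms(4) by linarith
  then have "24 * (\<epsilon> * real n) \<le> 60 * \<epsilon> * real k"
    using vertex_count_slack[of \<epsilon> "real k" "real n"] assms(1-4) n1 D1 Dle by linarith
  then have "2 * real k + real l + 48 * real D \<le> 2 * real n" using Dle l_half assms(7) by linarith
  moreover have "2 * n < 2 * k + l + 48 * D"
    using card_lt_if_paths_bounded[OF rb br red blue assms(4)] assms(6) by simp
  ultimately show False by linarith
qed

end
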